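(* Let $\mathcal{P}$ be a compactness-like topological property. Let $\mathcal{Q}$ be a topological property which is either • clopen hereditary, inverse invariant under perfect mappings and satisfying Mrówka's condition (W), or • strong zero-dimensionality. Let $X$ be a Tychonoff non-$\mathcal P$ space with $\mathcal Q$. The following are equivalent: (1) $X$ is locally-$\mathcal P$. (2) $X$ has a one-point Tychonoff extension with both $\mathcal P$ and $\mathcal Q$.
   Context: Conventions: compact spaces and Tychonoff spaces are Hausdorff. Topological properties are assumed to be satisfied by at least one space. A mapping $f:X\to Y$ is perfect if $X$ is Hausdorff and $f$ is continuous, closed (not necessarily surjective) and has compact fibers. A topological property $\mathcal{P}$ is invariant (inverse invariant) under perfect mappings if for every perfect surjective $f:X\to Y$, $Y$ has $\mathcal P$ whenever $X$ does ($X$ has $\mathcal P$ whenever $Y$ does); it is perfect if both hold. $\mathcal P$ is clopen hereditary if every clopen subset of a space with $\mathcal P$ has $\mathcal P$; finitely additive if $X_1\oplus\cdots\oplus X_n$ has $\mathcal P$ whenever every $X_i$ does. $\mathcal P$ satisfies Mrówka's condition (W) if: whenever $X$ is a Tychonoff space having a point $p$ with an open base $\mathscr B$ for $X$ at $p$ such that $X\setminus B$ has $\mathcal P$ for every $B\in\mathscr B$, then $X$ has $\mathcal P$. $\mathcal P$ is compactness-like if it is clopen hereditary, finitely additive, perfect and satisfies (W). $X$ is locally-$\mathcal P$ if each $x\in X$ has an open neighborhood $U$ with $\mathrm{cl}_XU$ having $\mathcal P$. A Tychonoff space is strongly zero-dimensional if its Stone–Čech compactification has an open base consisting of clopen sets.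 A space $Y$ is a one-point extension of $X$ if it contains $X$ as a dense subspace and $Y\setminus X$ is a single point. *)

theory Defs
  imports "HOL-Analysis.Analysis"
begin

(* A topological property is a predicate on the spaces whose points are taken from one
   arbitrary type 'a, which serves as the universe of discourse.  Since HOL predicates are
   monomorphic, constructions that leave the type (topological sums, one-point extensions)
   are taken up to homeomorphism inside the universe. *)

definition topological_property :: "('a topology \<Rightarrow> bool) \<Rightarrow> bool" where
  "topological_property P \<longleftrightarrow>
     (\<forall>X Y. X homeomorphic_space Y \<longrightarrow> P X \<longrightarrow> P Y) \<and> (\<exists>X. P X)"

definition Tychonoff_space :: "'a topology \<Rightarrow> bool" where
  "Tychonoff_space X \<longleftrightarrow> completely_regular_space X \<and> Hausdorff_space X"

(* perfect_map of the library already includes surjectivity, but not that the domain is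
   Hausdorff. *)

definition invariant_perfect :: "('a topology \<Rightarrow> bool) \<Rightarrow> bool" where
  "invariant_perfect P \<longleftrightarrow>
     (\<forall>X Y f. Hausdorff_space X \<and> perfect_map X Y f \<longrightarrow> P X \<longrightarrow> P Y)"

definition inverse_invariant_perfect :: "('a topology \<Rightarrow> bool) \<Rightarrow> bool" where
  "inverse_invariant_perfect P \<longleftrightarrow>
     (\<forall>X Y f. Hausdorff_space X \<and> perfect_map X Y f \<longrightarrow> P Y \<longrightarrow> P X)"

definition perfect_property :: "('a topology \<Rightarrow> bool) \<Rightarrow> bool" where
  "perfect_property P \<longleftrightarrow> invariant_perfect P \<and> inverse_invariant_perfect P"

definition clopen_hereditary :: "('a topology \<Rightarrow> bool) \<Rightarrow> bool" where
  "clopen_hereditary P \<longleftrightarrow>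
     (\<forall>X U. P X \<and> openin X U \<and> closedin X U \<longrightarrow> P (subtopology X U))"

(* The points of sum_topology are pairs (i, x), so the sum is represented by a homeomorphic
   space Z with points in the universe. *)
definition finitely_additive :: "('a topology \<Rightarrow> bool) \<Rightarrow> bool" where
  "finitely_additive P \<longleftrightarrow>
     (\<forall>(n::nat) X Z. 0 < n \<and> (\<forall>i<n. P (X i)) \<and> Z homeomorphic_space sum_topology X {..<n}
        \<longrightarrow> P Z)"

definition open_base_at :: "'a topology \<Rightarrow> 'a \<Rightarrow> 'a set set \<Rightarrow> bool" where
  "open_base_at X p \<B> \<longleftrightarrow>
     (\<forall>B\<in>\<B>. openin X B \<and> p \<in> B) \<and> (\<forall>V. openin X V \<and> p \<in> V \<longrightarrow> (\<exists>B\<in>\<B>. B \<subseteq> V))"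

definition Mrowka_W :: "('a topology \<Rightarrow> bool) \<Rightarrow> bool" where
  "Mrowka_W P \<longleftrightarrow>
     (\<forall>X p \<B>. Tychonoff_space X \<and> p \<in> topspace X \<and> open_base_at X p \<B> \<and>
        (\<forall>B\<in>\<B>. P (subtopology X (topspace X - B))) \<longrightarrow> P X)"

definition compactness_like :: "('a topology \<Rightarrow> bool) \<Rightarrow> bool" where
  "compactness_like P \<longleftrightarrow>
     topological_property P \<and> clopen_hereditary P \<and> finitely_additive P \<and>
     perfect_property P \<and> Mrowka_W P"

definition locally_property :: "('a topology \<Rightarrow> bool) \<Rightarrow> 'a topology \<Rightarrow> bool" where
  "locally_property P X \<longleftrightarrow>
     (\<forall>x\<in>topspace X. \<exists>U. openin X U \<and> x \<in> U \<and> P (subtopology X (X closure_of U)))"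

(* The Stone-Cech compactification of a Tychonoff space X: the closure of the image of X under
   the evaluation map into the cube [0,1]^C(X,[0,1]).  The members of C(X,[0,1]) are taken
   extensional, so that each continuous function on the carrier occurs exactly once. *)

definition unit_functions :: "'a topology \<Rightarrow> ('a \<Rightarrow> real) set" where
  "unit_functions X = {f \<in> extensional (topspace X). continuous_map X (top_of_set {0..1}) f}"

definition unit_cube :: "'a topology \<Rightarrow> (('a \<Rightarrow> real) \<Rightarrow> real) topology" where
  "unit_cube X = product_topology (\<lambda>_. top_of_set {0..1}) (unit_functions X)"

definition evaluation_map :: "'a topology \<Rightarrow> 'a \<Rightarrow> ('a \<Rightarrow> real) \<Rightarrow> real" where
  "evaluation_map X x = (\<lambda>f\<in>unit_functions X. f x)"

definition Stone_Cech :: "'a topology \<Rightarrow> (('a \<Rightarrow> real) \<Rightarrow> real) topology" where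
  "Stone_Cech X =
     subtopology (unit_cube X) (unit_cube X closure_of (evaluation_map X ` topspace X))"

definition strongly_zero_dimensional :: "'a topology \<Rightarrow> bool" where
  "strongly_zero_dimensional X \<longleftrightarrow>
     Tychonoff_space X \<and>
     (\<exists>\<B>. (\<forall>B\<in>\<B>. openin (Stone_Cech X) B \<and> closedin (Stone_Cech X) B) \<and>
          openin (Stone_Cech X) = arbitrary union_of (\<lambda>B. B \<in> \<B>))"

(* X is identified with its image under an embedding e; if the carrier of X is all of the type,
   there is no room for a literal superspace. *)
definition one_point_extension :: "'a topology \<Rightarrow> 'b topology \<Rightarrow> bool" where
  "one_point_extension X Y \<longleftrightarrow>
     (\<exists>e p. embedding_map X Y e \<and>
            Y closure_of (e ` topspace X) = topspace Y \<and>
            topspace Y - e ` topspace X = {p})"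

end

theory Submission
  imports Defs
begin

text \<open>Let \<open>F\<close> be the set of continuous real functions \<open>f\<close> on \<open>X\<close> such that every set
  \<open>{\<bar>f\<bar> \<ge> \<epsilon>}\<close> with \<open>\<epsilon> > 0\<close> has \<open>P\<close>. The one-point extension is the weak topology induced by \<open>F\<close> on
  \<open>X \<union> {p}\<close>, where members of \<open>F\<close> are extended by \<open>0\<close> at \<open>p\<close>. Local \<open>P\<close> makes \<open>F\<close> separate
  points from closed sets. The complement of a neighbourhood of \<open>p\<close> is a closed subset of a finite
  union of sets \<open>{\<bar>f\<bar> \<ge> \<epsilon>}\<close>, hence it has \<open>P\<close>; so \<open>p\<close> is not isolated (as \<open>X\<close> lacks \<open>P\<close>), and
  condition (W) gives \<open>P\<close>. The same condition gives \<open>Q\<close>, because closed subsets of \<open>X\<close> inherit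
  \<open>Q\<close>. In the strongly zero-dimensional case, a clopen subset of \<open>X\<close> that stays away from \<open>p\<close>
  remains clopen in the extension.\<close>

section \<open>Properties closed under perfect maps\<close>

lemma homeomorphic_map_pullback_topology:
  assumes "inj_on f S" "f ` S \<subseteq> topspace T"
  shows "homeomorphic_map (pullback_topology S f T) (subtopology T (f ` S)) f"
proof (rule bijective_open_imp_homeomorphic_map)
  have top: "topspace (pullback_topology S f T) = S"
    using assms(2) by (auto simp: topspace_pullback_topology)
  have "continuous_map (pullback_topology S f T) T (id \<circ> f)"
    by (intro continuous_map_pullback continuous_map_id)
  then show "continuous_map (pullback_topology S f T) (subtopology T (f ` S)) f"
    using top by (simp add: continuous_map_in_subtopology)
  show "open_map (pullback_topology S f T) (subtopology T (f ` S)) f"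
    by (auto simp: open_map_def openin_pullback_topology openin_subtopology)
  show "f ` topspace (pullback_topology S f T) = topspace (subtopology T (f ` S))"
    using top assms(2) by auto
  show "inj_on f (topspace (pullback_topology S f T))"
    using top assms(1) by simp
qed

text \<open>Pulling \<open>T\<close> back along the inverse of \<open>g\<close> gives a space whose
  points lie in \<open>'a\<close>. Properties are predicates on such spaces only, so auxiliary
  spaces over other types have to be moved there.\<close>

lemma homeomorphic_copy:
  fixes g :: "'b \<Rightarrow> 'a"
  assumes "inj_on g (topspace T)"
  obtains Z :: "'a topology" where "homeomorphic_map T Z g"
proof -
  let ?h = "inv_into (topspace T) g"
  have "?h ` g ` topspace T = topspace T"
    using assms by force
  then have "homeomorphic_map (pullback_topology (g ` topspace T) ?h T) T ?h"
    using homeomorphic_map_pullback_topology[of ?h "g ` topspace T" T]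
    by (simp add: inj_on_inv_into)
  then obtain k where "homeomorphic_maps (pullback_topology (g ` topspace T) ?h T) T ?h k"
    unfolding homeomorphic_map_maps by blast
  then have k: "homeomorphic_maps T (pullback_topology (g ` topspace T) ?h T) k ?h"
    by (rule homeomorphic_maps_sym[THEN iffD1])
  have top: "topspace (pullback_topology (g ` topspace T) ?h T) = g ` topspace T"
    using assms by (auto simp: topspace_pullback_topology)
  have "k x = g x" if "x \<in> topspace T" for x
  proof -
    have "?h (k x) = x" "k x \<in> g ` topspace T"
      using k that top by (auto simp: homeomorphic_maps_def continuous_map_def)
    then show ?thesis
      by (metis f_inv_into_f)
  qed
  then show thesis
    using k homeomorphic_map_eq[of T _ k g] that unfolding homeomorphic_maps_map by blast
qed

text \<open>An infinite set absorbs a countable factor. Points of a sum indexed by naturals are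
  pairs in \<open>nat \<times> 'a\<close>, so this makes room for the sum in
  \<open>'a\<close>.\<close>

lemma ex_inj_nat_times:
  includes cardinal_syntax
  assumes "infinite (UNIV :: 'a set)"
  obtains g :: "nat \<times> 'a \<Rightarrow> 'a" where "inj g"
proof -
  have "|UNIV :: nat set| \<le>o |UNIV :: 'a set|"
    using assms infinite_iff_card_of_nat by blast
  then have "|(UNIV :: nat set) \<times> (UNIV :: 'a set)| \<le>o |UNIV :: 'a set|"
    using card_of_Times_infinite[OF assms, of "UNIV :: nat set"] ordIso_imp_ordLeq by blast
  then show thesis
    using that by (auto simp flip: card_of_ordLeq)
qed

lemma sum_topology_copy:
  fixes T :: "nat \<Rightarrow> 'a topology"
  assumes "infinite (UNIV :: 'a set)"
  obtains Z :: "'a topology" and g h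
  where "homeomorphic_map (sum_topology T I) Z g" "homeomorphic_map Z (sum_topology T I) h"
proof -
  obtain g :: "nat \<times> 'a \<Rightarrow> 'a" where "inj g"
    using ex_inj_nat_times[OF assms] .
  then have "inj_on g (topspace (sum_topology T I))"
    using inj_on_subset by blast
  then obtain Z where g: "homeomorphic_map (sum_topology T I) Z g"
    using homeomorphic_copy by blast
  then obtain h where "homeomorphic_maps (sum_topology T I) Z g h"
    unfolding homeomorphic_map_maps by blast
  then have "homeomorphic_map Z (sum_topology T I) h"
    by (simp add: homeomorphic_maps_map)
  with g show thesis
    using that by blast
qed

text \<open>The image of a closed set is the union of its finitely many slices, each closed in
  \<open>X\<close>, and a fibre has at most one point per index. Through this fold the axioms on
  perfect maps become statements about closed subsets.\<close>

lemma perfect_map_sum_of_closed: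
  assumes I: "finite I" and A: "\<And>i. i \<in> I \<Longrightarrow> closedin X (A i)"
  shows "perfect_map (sum_topology (\<lambda>i. subtopology X (A i)) I) (subtopology X (\<Union>i\<in>I. A i)) snd"
proof -
  let ?S = "sum_topology (\<lambda>i. subtopology X (A i)) I" and ?U = "subtopology X (\<Union>i\<in>I. A i)"
  have sub: "A i \<subseteq> topspace X" if "i \<in> I" for i
    using A[OF that] closedin_subset by blast
  have top: "topspace ?S = Sigma I A" "topspace ?U = (\<Union>i\<in>I. A i)"
    using sub by (force simp: Sigma_def)+
  have cont: "continuous_map ?S ?U snd"
  proof -
    have "continuous_map ?S X snd"
      unfolding continuous_map_def
    proof (intro conjI allI impI)
      show "snd \<in> topspace ?S \<rightarrow> topspace X"
        using sub top by auto
      fix V assume V: "openin X V"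
      have "{x. (i, x) \<in> Sigma I A \<and> x \<in> V} = V \<inter> A i" if "i \<in> I" for i
        using that by auto
      then show "openin ?S {x \<in> topspace ?S. snd x \<in> V}"
        unfolding top openin_sum_topology using V sub
        by (auto simp: openin_subtopology) blast
    qed
    then show ?thesis
      by (auto simp: continuous_map_in_subtopology)
  qed
  have closed: "closed_map ?S ?U snd"
    unfolding closed_map_def
  proof (intro allI impI)
    fix C assume "closedin ?S C"
    then have C: "C \<subseteq> Sigma I A" "\<And>i. i \<in> I \<Longrightarrow> closedin (subtopology X (A i)) {x. (i, x) \<in> C}"
      using top by (auto simp: closedin_sum_topology dest: closedin_subset)
    have "closedin X {x. (i, x) \<in> C}" if "i \<in> I" for i
      using C(2)[OF that] A[OF that] closedin_trans_full by blast
    then have "closedin X (\<Union>i\<in>I. {x. (i, x) \<in> C})"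
      using I by (intro closedin_Union) auto
    moreover have "snd ` C = (\<Union>i\<in>I. {x. (i, x) \<in> C})" "snd ` C \<subseteq> (\<Union>i\<in>I. A i)"
      using C(1) by force+
    ultimately show "closedin ?U (snd ` C)"
      by (metis closedin_subset_topspace)
  qed
  have fib: "compactin ?S {x \<in> topspace ?S. snd x = y}" for y
  proof (rule finite_imp_compactin)
    have "{x \<in> topspace ?S. snd x = y} \<subseteq> (\<lambda>i. (i, y)) ` I"
      by force
    then show "finite {x \<in> topspace ?S. snd x = y}"
      using I finite_subset by blast
  qed auto
  show ?thesis
    unfolding perfect_map_def proper_map_def
    using cont closed fib top by (auto simp: snd_image_Sigma)
qed

lemma Hausdorff_space_sum_topology:
  assumes "\<And>i. i \<in> I \<Longrightarrow> Hausdorff_space (T i)"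
  shows "Hausdorff_space (sum_topology T I)"
  unfolding Hausdorff_space_def
proof clarsimp
  fix i x j y
  assume ij: "i \<in> I" "j \<in> I" "x \<in> topspace (T i)" "y \<in> topspace (T j)" and ne: "i = j \<longrightarrow> x \<noteq> y"
  show "\<exists>U. openin (sum_topology T I) U \<and>
          (\<exists>V. openin (sum_topology T I) V \<and> (i, x) \<in> U \<and> (j, y) \<in> V \<and> disjnt U V)"
  proof (cases "i = j")
    case True
    then obtain U V where UV: "openin (T i) U" "openin (T i) V" "x \<in> U" "y \<in> V" "disjnt U V"
      using assms[OF ij(1)] ij ne unfolding Hausdorff_space_def by blast
    have "openin (sum_topology T I) (Pair i ` U)" "openin (sum_topology T I) (Pair i ` V)"
      using UV open_map_component_injection[OF ij(1), of T] by (auto simp: open_map_def)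
    then show ?thesis
      using UV True by (intro exI[of _ "Pair i ` U"] conjI exI[of _ "Pair i ` V"])
        (auto simp: disjnt_def)
  next
    case False
    have "openin (sum_topology T I) (Pair i ` topspace (T i))"
         "openin (sum_topology T I) (Pair j ` topspace (T j))"
      using ij open_map_component_injection[of _ I T] by (auto simp: open_map_def)
    then show ?thesis
      using ij False by (intro exI[of _ "Pair i ` topspace (T i)"] conjI
          exI[of _ "Pair j ` topspace (T j)"]) (auto simp: disjnt_def)
  qed
qed

section \<open>Closed subspaces, finite unions and compact spaces\<close>

lemma topological_propertyD:
  "topological_property R \<Longrightarrow> X homeomorphic_space Y \<Longrightarrow> R X \<Longrightarrow> R Y"
  unfolding topological_property_def by blast

text \<open>A closed set \<open>A\<close> is a clopen summand of the sum of \<open>Y\<close> and \<open>A\<close>, and folding that sum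
  onto \<open>Y\<close> is a perfect map.\<close>

lemma closed_hereditary:
  fixes R :: "'a topology \<Rightarrow> bool"
  assumes inf: "infinite (UNIV :: 'a set)"
    and R: "topological_property R" "clopen_hereditary R" "inverse_invariant_perfect R"
    and Y: "Hausdorff_space Y" "R Y" "closedin Y A"
  shows "R (subtopology Y A)"
proof -
  \<comment> \<open>Index 0 carries the whole space, which makes the fold onto \<open>Y\<close>
    surjective; index 1 carries \<open>A\<close>.\<close>
  define D where "D i = (if i = 0 then topspace Y else A)" for i :: nat
  let ?I = "{..<2::nat}" and ?T = "\<lambda>i. subtopology Y (D i)"
  obtain Z :: "'a topology" and g h where g: "homeomorphic_map (sum_topology ?T ?I) Z g"
    and h: "homeomorphic_map Z (sum_topology ?T ?I) h"
    using sum_topology_copy[OF inf] .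
  have cl: "closedin Y (D i)" for i
    using Y by (simp add: D_def)
  have "(\<Union>i\<in>?I. D i) = topspace Y"
    using closedin_subset[OF Y(3)] by (auto simp: D_def)
  then have "perfect_map (sum_topology ?T ?I) Y snd"
    using perfect_map_sum_of_closed[of ?I Y D] cl by simp
  then have "perfect_map Z Y (snd \<circ> h)"
    using perfect_map_compose[OF homeomorphic_imp_perfect_map[OF h]] by blast
  moreover have "Hausdorff_space Z"
    using g Hausdorff_space_sum_topology[of ?I ?T] Y(1)
    by (metis Hausdorff_space_subtopology homeomorphic_Hausdorff_space
        homeomorphic_map_imp_homeomorphic_space)
  ultimately have "R Z"
    using R(3) Y(2) unfolding inverse_invariant_perfect_def by blast
  let ?e = "g \<circ> Pair 1"
  have emb: "embedding_map (?T 1) Z ?e"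
    using embedding_map_component_injection[of 1 ?I ?T] g
    by (intro embedding_map_compose) (auto simp: surjective_embedding_map[symmetric])
  have "open_map (?T 1) Z ?e" "closed_map (?T 1) Z ?e"
    using open_map_component_injection[of 1 ?I ?T] closed_map_component_injection[of 1 ?I ?T] g
    by (auto intro!: open_map_compose closed_map_compose
        simp: homeomorphic_imp_open_map homeomorphic_imp_closed_map)
  then have "R (subtopology Z (?e ` topspace (?T 1)))"
    using R(2) \<open>R Z\<close> unfolding clopen_hereditary_def open_map_def closed_map_def
    by (metis closedin_topspace openin_topspace)
  then have "R (?T 1)"
    using embedding_map_imp_homeomorphic_space[OF emb] R(1) topological_propertyD
      homeomorphic_space_sym by blast
  then show ?thesis
    by (simp add: D_def)
qed

text \<open>By convention some space has \<open>R\<close>. Its empty subspace is clopen, and it is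
  the same topology as the empty subspace of any other space.\<close>

lemma compactness_like_empty:
  assumes "compactness_like R" shows "R (subtopology X {})"
proof -
  obtain X0 where "R X0" and R: "topological_property R" "clopen_hereditary R"
    using assms unfolding compactness_like_def topological_property_def by blast
  then have "R (subtopology X0 {})"
    unfolding clopen_hereditary_def by (metis openin_empty closedin_empty)
  then show ?thesis
    by simp
qed

text \<open>The sum of \<open>A\<close> and \<open>B\<close> has \<open>R\<close> by finite
  additivity and folds perfectly onto the union, so \<open>R\<close> passes to the image.\<close>

lemma compactness_like_Union:
  fixes R :: "'a topology \<Rightarrow> bool"
  assumes inf: "infinite (UNIV :: 'a set)" and R: "compactness_like R"
    and X: "Hausdorff_space X" and A: "closedin X A" "R (subtopology X A)"
    and B: "closedin X B" "R (subtopology X B)"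
  shows "R (subtopology X (A \<union> B))"
proof -
  define D where "D i = (if i = 0 then A else B)" for i :: nat
  let ?I = "{..<2::nat}" and ?T = "\<lambda>i. subtopology X (D i)"
  obtain Z :: "'a topology" and g h where g: "homeomorphic_map (sum_topology ?T ?I) Z g"
    and h: "homeomorphic_map Z (sum_topology ?T ?I) h"
    using sum_topology_copy[OF inf] .
  have "(\<Union>i\<in>?I. D i) = A \<union> B"
    by (auto simp: D_def numeral_2_eq_2 lessThan_Suc)
  then have "perfect_map (sum_topology ?T ?I) (subtopology X (A \<union> B)) snd"
    using perfect_map_sum_of_closed[of ?I X D] A B by (simp add: D_def)
  then have "perfect_map Z (subtopology X (A \<union> B)) (snd \<circ> h)"
    using perfect_map_compose[OF homeomorphic_imp_perfect_map[OF h]] by blast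
  moreover have "Hausdorff_space Z"
    using g Hausdorff_space_sum_topology[of ?I ?T] X
    by (metis Hausdorff_space_subtopology homeomorphic_Hausdorff_space
        homeomorphic_map_imp_homeomorphic_space)
  moreover have "R Z"
  proof -
    have "\<forall>i<2. R (?T i)"
      using A B by (simp add: D_def)
    moreover have "Z homeomorphic_space sum_topology ?T ?I"
      using h homeomorphic_map_imp_homeomorphic_space by blast
    moreover have "finitely_additive R"
      using R by (simp add: compactness_like_def)
    ultimately show ?thesis
      unfolding finitely_additive_def by (metis zero_less_numeral)
  qed
  ultimately show ?thesis
    using R unfolding compactness_like_def perfect_property_def invariant_perfect_def by blast
qed

lemma compactness_like_UN:
  fixes R :: "'a topology \<Rightarrow> bool"
  assumes inf: "infinite (UNIV :: 'a set)" and R: "compactness_like R"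
    and X: "Hausdorff_space X" and "finite I"
    and A: "\<And>i. i \<in> I \<Longrightarrow> closedin X (A i)" "\<And>i. i \<in> I \<Longrightarrow> R (subtopology X (A i))"
  shows "R (subtopology X (\<Union>i\<in>I. A i))"
  using \<open>finite I\<close> A
proof (induction I)
  case empty
  then show ?case
    using compactness_like_empty[OF R] by (simp only: image_empty Union_empty)
next
  case (insert i I)
  have "closedin X (\<Union>i\<in>I. A i)"
    using insert by (intro closedin_Union) auto
  then show ?case
    using compactness_like_Union[OF inf R X, of "A i" "\<Union>i\<in>I. A i"] insert by simp
qed

text \<open>A one-point space has \<open>R\<close> by (W): for the base \<open>{{x}}\<close> the
  only complement is empty. A nonempty compact Hausdorff space maps perfectly onto a one-point
  space, so inverse invariance applies.\<close>

lemma compactness_like_compact: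
  assumes R: "compactness_like R" and X: "Hausdorff_space X" "compact_space X"
  shows "R X"
proof (cases "topspace X = {}")
  case True
  then show ?thesis
    using compactness_like_empty[OF R, of X] by (metis subtopology_topspace)
next
  case False
  then obtain x where x: "x \<in> topspace X"
    by blast
  let ?S = "subtopology X {x}"
  have H: "Hausdorff_space ?S"
    using X(1) Hausdorff_space_subtopology by blast
  have "compact_space ?S"
    using x by (simp add: compact_space_subtopology)
  then have "Tychonoff_space ?S"
    using H unfolding Tychonoff_space_def
    by (simp add: compact_Hausdorff_or_regular_imp_normal_space Hausdorff_imp_t1_space
        normal_imp_completely_regular_space)
  moreover have "open_base_at ?S x {{x}}"
    using x by (auto simp: open_base_at_def openin_subtopology_refl)
  moreover have "R (subtopology ?S (topspace ?S - {x}))"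
    using compactness_like_empty[OF R] x by (metis Diff_cancel Int_insert_right_if1 inf_bot_right topspace_subtopology)
  moreover have "x \<in> topspace ?S"
    using x by simp
  ultimately have "R ?S"
    using R unfolding compactness_like_def Mrowka_W_def by (metis singletonD)
  moreover have "perfect_map X ?S (\<lambda>_. x)"
    unfolding perfect_map_def proper_map_def
  proof (intro conjI ballI)
    show c: "continuous_map X ?S (\<lambda>_. x)"
      using x by simp
    show "closed_map X ?S (\<lambda>_. x)"
      using continuous_imp_closed_map c X H by blast
    show "compactin X {z \<in> topspace X. x = y}" if "y \<in> topspace ?S" for y
      using that X(2) x by (simp add: compact_space_def)
    show "(\<lambda>_. x) ` topspace X = topspace ?S"
      using x by auto
  qed
  ultimately show ?thesis
    using R X unfolding compactness_like_def perfect_property_def inverse_invariant_perfect_def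
    by blast
qed

text \<open>Finite spaces are compact. Infinitude of \<open>X\<close> supplies the room needed in
  the universe, both for sums and for the extra point.\<close>

lemma compactness_like_imp_infinite:
  assumes R: "compactness_like R" and X: "Hausdorff_space X" "\<not> R X"
  shows "infinite (topspace X)"
  using compactness_like_compact[OF R X(1)] X(2) finite_imp_compactin[of "topspace X" X]
  by (auto simp: compact_space_def)

section \<open>Strong zero-dimensionality\<close>

lemma Tychonoff_space_homeomorphic:
  "X homeomorphic_space Y \<Longrightarrow> Tychonoff_space X \<longleftrightarrow> Tychonoff_space Y"
  unfolding Tychonoff_space_def
  using homeomorphic_Hausdorff_space homeomorphic_completely_regular_space by blast

lemma Tychonoff_space_subtopology: "Tychonoff_space X \<Longrightarrow> Tychonoff_space (subtopology X S)"
  by (simp add: Tychonoff_space_def Hausdorff_space_subtopology completely_regular_space_subtopology)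

lemma Tychonoff_space_product_topology:
  "(\<And>i. i \<in> I \<Longrightarrow> Tychonoff_space (X i)) \<Longrightarrow> Tychonoff_space (product_topology X I)"
  by (simp add: Tychonoff_space_def Hausdorff_space_product_topology completely_regular_space_product_topology)

lemma Tychonoff_space_euclidean: "Tychonoff_space (euclidean :: 'a::metric_space topology)"
  by (simp add: Tychonoff_space_def metrizable_imp_completely_regular_space metrizable_space_euclidean
      Hausdorff_space_euclidean)

lemma Stone_Cech_compact: "compact_space (Stone_Cech X)"
  and Stone_Cech_Tychonoff: "Tychonoff_space (Stone_Cech X)"
proof -
  have "compact_space (unit_cube X)"
    by (auto simp: unit_cube_def compact_space_product_topology compact_space_subtopology)
  then show "compact_space (Stone_Cech X)"
    by (simp add: Stone_Cech_def closedin_compact_space compact_space_subtopology)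
  show "Tychonoff_space (Stone_Cech X)"
    unfolding Stone_Cech_def unit_cube_def
    by (intro Tychonoff_space_subtopology Tychonoff_space_product_topology Tychonoff_space_euclidean)
qed

lemma evaluation_map_in_unit_cube:
  "evaluation_map X ` topspace X \<subseteq> topspace (unit_cube X)"
proof -
  have "f x \<in> {0..1}" if "x \<in> topspace X" "f \<in> unit_functions X" for f x
    using that continuous_map_image_subset_topspace[of X "top_of_set {0..1}" f]
    unfolding unit_functions_def by auto
  then show ?thesis
    unfolding evaluation_map_def unit_cube_def by (simp add: image_subset_iff)
qed

lemma continuous_map_evaluation: "continuous_map X (Stone_Cech X) (evaluation_map X)"
proof -
  have "continuous_map X (unit_cube X) (evaluation_map X)"
    unfolding unit_cube_def continuous_map_componentwise evaluation_map_def
    by (auto simp: unit_functions_def)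
  then show ?thesis
    using closure_of_subset[OF evaluation_map_in_unit_cube, of X]
    unfolding Stone_Cech_def continuous_map_in_subtopology by (simp add: image_subset_iff_funcset)
qed

text \<open>The coordinate of index \<open>f\<close> is the continuous extension of \<open>f\<close>
  to the compactification.\<close>

lemma continuous_map_Stone_Cech_projection:
  assumes "f \<in> unit_functions X"
  shows "continuous_map (Stone_Cech X) (top_of_set {0..1}) (\<lambda>z. z f)"
  unfolding Stone_Cech_def unit_cube_def
  by (rule continuous_map_from_subtopology[OF
        continuous_map_product_projection[OF assms, of "\<lambda>_. top_of_set {0..1}"]])

text \<open>Allows strict inequalities on the compactification to be tested at points of
  \<open>X\<close>: if they hold at some \<open>z\<close>, they hold at some
  \<open>evaluation_map X x\<close>.\<close>

lemma evaluation_map_dense: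
  assumes "openin (Stone_Cech X) V" "z \<in> V"
  obtains x where "x \<in> topspace X" "evaluation_map X x \<in> V"
proof -
  obtain W where W: "openin (unit_cube X) W"
    "V = W \<inter> (unit_cube X closure_of (evaluation_map X ` topspace X))"
    using assms(1) by (auto simp: Stone_Cech_def openin_subtopology)
  then obtain x where "x \<in> topspace X" "evaluation_map X x \<in> W"
    using assms(2) by (auto simp: in_closure_of)
  then show thesis
    using that W closure_of_subset[OF evaluation_map_in_unit_cube, of X] by blast
qed

lemma evaluation_map_apply: "f \<in> unit_functions X \<Longrightarrow> evaluation_map X x f = f x"
  by (simp add: evaluation_map_def)

section \<open>Strong zero-dimensionality expressed by clopen sets of the space itself\<close>

lemma openin_real_preimage_less:
  fixes f :: "'a \<Rightarrow> real"
  assumes "continuous_map X euclideanreal f"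
  shows "openin X {x \<in> topspace X. f x < c}" "openin X {x \<in> topspace X. c < f x}"
  using openin_continuous_map_preimage[OF assms, of "{..<c}"]
    openin_continuous_map_preimage[OF assms, of "{c<..}"] by auto

lemma closedin_real_preimage_le:
  fixes f :: "'a \<Rightarrow> real"
  assumes "continuous_map X euclideanreal f"
  shows "closedin X {x \<in> topspace X. f x \<le> c}" "closedin X {x \<in> topspace X. c \<le> f x}"
  using closedin_continuous_map_preimage[OF assms, of "{..c}"]
    closedin_continuous_map_preimage[OF assms, of "{c..}"] by auto

text \<open>The intrinsic form of strong zero-dimensionality: completely separated sets are
  separated by a clopen set. It can be carried from \<open>X\<close> to an extension without
  comparing two compactifications.\<close>

definition clopen_separation :: "'a topology \<Rightarrow> bool" where
  "clopen_separation X \<longleftrightarrow>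
     (\<forall>f. continuous_map X euclideanreal f \<longrightarrow>
        (\<exists>U. openin X U \<and> closedin X U \<and> {x \<in> topspace X. f x \<le> 0} \<subseteq> U \<and> (\<forall>x\<in>U. f x < 1)))"

lemma clopen_separationE:
  fixes f :: "'a \<Rightarrow> real"
  assumes "clopen_separation X" "continuous_map X euclideanreal f" "a < b"
  obtains U where "openin X U" "closedin X U" "\<And>x. x \<in> topspace X \<Longrightarrow> f x \<le> a \<Longrightarrow> x \<in> U"
    "\<And>x. x \<in> U \<Longrightarrow> f x < b"
proof -
  \<comment> \<open>The affine change of scale sends the levels \<open>a\<close> and
    \<open>b\<close> to 0 and 1.\<close>
  let ?g = "\<lambda>x. (f x - a) * inverse (b - a)"
  have "continuous_map X euclideanreal ?g"
    using assms(2) by (intro continuous_intros)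
  then obtain U where U: "openin X U" "closedin X U" "{x \<in> topspace X. ?g x \<le> 0} \<subseteq> U" "\<forall>x\<in>U. ?g x < 1"
    using assms(1) unfolding clopen_separation_def by blast
  show thesis
  proof
    show "x \<in> U" if "x \<in> topspace X" "f x \<le> a" for x
      using U(3) that assms(3) by (auto simp: mult_le_0_iff)
    show "f x < b" if "x \<in> U" for x
      using U(4) that assms(3) by (auto simp: field_simps)
  qed (use U in auto)
qed

text \<open>Extend the truncated function to the compactification. Its zero set is compact there, so
  finitely many basic clopen sets cover it inside the region where the extension is below 1. Their
  union is clopen and is pulled back along the evaluation map.\<close>

lemma strongly_zero_dimensional_imp_clopen_separation:
  assumes "strongly_zero_dimensional X"
  shows "clopen_separation X"
  unfolding clopen_separation_def
proof (intro allI impI)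
  fix f :: "'a \<Rightarrow> real" assume f: "continuous_map X euclideanreal f"
  let ?\<beta> = "Stone_Cech X"
  obtain \<B> where clopen: "\<And>B. B \<in> \<B> \<Longrightarrow> openin ?\<beta> B \<and> closedin ?\<beta> B"
    and base: "openin ?\<beta> = arbitrary union_of (\<lambda>B. B \<in> \<B>)"
    using assms unfolding strongly_zero_dimensional_def by blast
  \<comment> \<open>Truncating to the unit interval and making the function extensional turns it
    into an index of the cube, so that \<open>\<lambda>z. z g\<close> extends it.\<close>
  define g where "g = (\<lambda>x\<in>topspace X. max 0 (min (f x) 1))"
  have "continuous_map X euclideanreal (\<lambda>x. max 0 (min (f x) 1))"
    using f by (intro continuous_map_real_max continuous_map_real_min) auto
  then have "continuous_map X (top_of_set {0..1}) g"
    unfolding g_def by (auto simp: continuous_map_in_subtopology)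
  then have g: "g \<in> unit_functions X"
    by (auto simp: unit_functions_def g_def)
  have cg: "continuous_map ?\<beta> euclideanreal (\<lambda>z. z g)"
    using continuous_map_Stone_Cech_projection[OF g] continuous_map_in_subtopology by blast
  let ?K = "{z \<in> topspace ?\<beta>. z g \<le> 0}" and ?O = "{z \<in> topspace ?\<beta>. z g < 1}"
  have K: "compactin ?\<beta> ?K"
    using closedin_real_preimage_le[OF cg] Stone_Cech_compact closedin_compact_space by blast
  have O: "openin ?\<beta> ?O"
    using openin_real_preimage_less[OF cg] by blast
  have "?K \<subseteq> \<Union>{B \<in> \<B>. B \<subseteq> ?O}"
  proof
    fix z assume "z \<in> ?K"
    then have "z \<in> ?O" by auto
    then obtain B where "B \<in> \<B>" "z \<in> B" "B \<subseteq> ?O"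
      using base[unfolded openin_topology_base_unique] O by blast
    then show "z \<in> \<Union>{B \<in> \<B>. B \<subseteq> ?O}" by blast
  qed
  then obtain \<U> where \<U>: "finite \<U>" "\<U> \<subseteq> {B \<in> \<B>. B \<subseteq> ?O}" "?K \<subseteq> \<Union>\<U>"
    using compactinD[OF K, of "{B \<in> \<B>. B \<subseteq> ?O}"] clopen by blast
  then have "\<forall>B\<in>\<U>. openin ?\<beta> B \<and> closedin ?\<beta> B"
    using clopen by blast
  then have W: "openin ?\<beta> (\<Union>\<U>)" "closedin ?\<beta> (\<Union>\<U>)"
    using \<U>(1) by (blast intro: openin_Union closedin_Union)+
  let ?U = "{x \<in> topspace X. evaluation_map X x \<in> \<Union>\<U>}"
  have top: "evaluation_map X x \<in> topspace ?\<beta>" if "x \<in> topspace X" for x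
    using that continuous_map_evaluation[of X] by (auto simp: continuous_map_def)
  show "\<exists>U. openin X U \<and> closedin X U \<and> {x \<in> topspace X. f x \<le> 0} \<subseteq> U \<and> (\<forall>x\<in>U. f x < 1)"
  proof (intro exI[of _ ?U] conjI)
    show "openin X ?U" "closedin X ?U"
      using W continuous_map_evaluation openin_continuous_map_preimage
        closedin_continuous_map_preimage by blast+
    show "{x \<in> topspace X. f x \<le> 0} \<subseteq> ?U"
    proof clarify
      fix x assume x: "x \<in> topspace X" "f x \<le> 0"
      then have "evaluation_map X x \<in> ?K"
        using top by (simp add: evaluation_map_apply[OF g]) (simp add: g_def)
      then show "evaluation_map X x \<in> \<Union>\<U>"
        using \<U> by blast
    qed
    show "\<forall>x\<in>?U. f x < 1"
    proof clarify
      fix x B assume x: "x \<in> topspace X" "evaluation_map X x \<in> B" "B \<in> \<U>"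
      then have "evaluation_map X x \<in> ?O"
        using \<U> by blast
      then have "g x < 1"
        by (simp add: evaluation_map_apply[OF g])
      then show "f x < 1"
        using x by (simp add: g_def split: if_splits)
    qed
  qed
qed

text \<open>A clopen subset of \<open>X\<close> has a continuous indicator function, whose extension
  to the compactification is still two-valued and so cuts out a clopen set there. Applied to a
  clopen set between two levels of a function separating \<open>z\<close> from the complement of
  \<open>V\<close>, this gives a clopen neighbourhood of \<open>z\<close> inside
  \<open>V\<close>.\<close>

lemma clopen_separation_imp_strongly_zero_dimensional:
  assumes X: "Tychonoff_space X" and sep: "clopen_separation X"
  shows "strongly_zero_dimensional X"
proof -
  let ?\<beta> = "Stone_Cech X" and ?e = "evaluation_map X"
  have "\<exists>W. (openin ?\<beta> W \<and> closedin ?\<beta> W) \<and> z \<in> W \<and> W \<subseteq> V" if V: "openin ?\<beta> V" "z \<in> V" for V z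
  proof -
    have "z \<in> topspace ?\<beta>"
      using V openin_subset by blast
    obtain h :: "_ \<Rightarrow> real" where h: "continuous_map ?\<beta> euclideanreal h" "h z = 0"
      "h ` (topspace ?\<beta> - V) \<subseteq> {1}"
      using Stone_Cech_Tychonoff[of X] V
      unfolding Tychonoff_space_def completely_regular_space_alt' by blast
    have "continuous_map X euclideanreal (h \<circ> ?e)"
      using continuous_map_compose[OF continuous_map_evaluation h(1)] .
    \<comment> \<open>The point \<open>z\<close> need not come from \<open>X\<close>, hence the
      slack in the levels: \<open>h < 1/3\<close> near \<open>z\<close> and \<open>h > 2/3\<close>
      near each point outside \<open>V\<close> are open conditions, which density transfers to
      points of \<open>X\<close>.\<close>
    then obtain U where U: "openin X U" "closedin X U"
      "\<And>x. x \<in> topspace X \<Longrightarrow> (h \<circ> ?e) x \<le> 1/3 \<Longrightarrow> x \<in> U" "\<And>x. x \<in> U \<Longrightarrow> (h \<circ> ?e) x < 2/3"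
      using clopen_separationE[OF sep, of "h \<circ> ?e" "1/3" "2/3"] by auto
    define \<kappa> :: "'a \<Rightarrow> real" where "\<kappa> = (\<lambda>x\<in>topspace X. if x \<in> U then 1 else 0)"
    have "continuous_map X (top_of_set {0..1}) \<kappa>"
      unfolding continuous_map_def
    proof (intro conjI allI impI)
      fix S :: "real set"
      have "{x \<in> topspace X. \<kappa> x \<in> S} =
        (if 1 \<in> S then U else {}) \<union> (if 0 \<in> S then topspace X - U else {})"
        using openin_subset[OF U(1)] by (auto simp: \<kappa>_def)
      then show "openin X {x \<in> topspace X. \<kappa> x \<in> S}"
        using U by auto
    qed (auto simp: \<kappa>_def)
    then have \<kappa>: "\<kappa> \<in> unit_functions X"
      by (auto simp: unit_functions_def \<kappa>_def)
    have c\<kappa>: "continuous_map ?\<beta> euclideanreal (\<lambda>z. z \<kappa>)"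
      using continuous_map_Stone_Cech_projection[OF \<kappa>] continuous_map_in_subtopology by blast
    \<comment> \<open>Otherwise the open set where the coordinate lies strictly between 0 and 1
      would contain the image of a point of \<open>X\<close>, where \<open>\<kappa>\<close> is 0 or
      1.\<close>
    have two: "y \<kappa> \<le> 0 \<or> 1 \<le> y \<kappa>" if "y \<in> topspace ?\<beta>" for y
    proof (rule ccontr)
      assume "\<not> ?thesis"
      then have "y \<in> {y \<in> topspace ?\<beta>. 0 < y \<kappa>} \<inter> {y \<in> topspace ?\<beta>. y \<kappa> < 1}"
        using that by auto
      then obtain x where "x \<in> topspace X" "0 < ?e x \<kappa>" "?e x \<kappa> < 1"
        using evaluation_map_dense[OF openin_Int[OF openin_real_preimage_less(2)[OF c\<kappa>]
              openin_real_preimage_less(1)[OF c\<kappa>]], of y 0 1] by blast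
      then show False
        by (simp add: evaluation_map_apply[OF \<kappa>]) (simp add: \<kappa>_def split: if_splits)
    qed
    let ?W = "{y \<in> topspace ?\<beta>. 0 < y \<kappa>}"
    have "?W = {y \<in> topspace ?\<beta>. 1 \<le> y \<kappa>}"
      using two by force
    then have W: "openin ?\<beta> ?W" "closedin ?\<beta> ?W"
      using openin_real_preimage_less(2)[OF c\<kappa>, of 0] closedin_real_preimage_le(2)[OF c\<kappa>, of 1]
      by (blast, metis)
    have "z \<in> ?W"
    proof (rule ccontr)
      assume "z \<notin> ?W"
      then have "z \<in> {y \<in> topspace ?\<beta>. y \<kappa> < 1} \<inter> {y \<in> topspace ?\<beta>. h y < 1/3}"
        using h(2) \<open>z \<in> topspace ?\<beta>\<close> by auto
      then obtain x where "x \<in> topspace X" "?e x \<kappa> < 1" "h (?e x) < 1/3"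
        using evaluation_map_dense[OF openin_Int[OF openin_real_preimage_less(1)[OF c\<kappa>]
              openin_real_preimage_less(1)[OF h(1)]], of z 1 "1/3"] by blast
      then show False
        using U(3)[of x] by (simp add: evaluation_map_apply[OF \<kappa>]) (simp add: \<kappa>_def split: if_splits)
    qed
    moreover have "?W \<subseteq> V"
    proof (rule ccontr)
      assume "\<not> ?W \<subseteq> V"
      then obtain y where "y \<in> {y \<in> topspace ?\<beta>. 0 < y \<kappa>} \<inter> {y \<in> topspace ?\<beta>. 2/3 < h y}"
        using h(3) by force
      then obtain x where "x \<in> topspace X" "0 < ?e x \<kappa>" "2/3 < h (?e x)"
        using evaluation_map_dense[OF openin_Int[OF openin_real_preimage_less(2)[OF c\<kappa>]
              openin_real_preimage_less(2)[OF h(1)]], of y 0 "2/3"] by blast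
      then show False
        using U(4)[of x] by (simp add: evaluation_map_apply[OF \<kappa>]) (simp add: \<kappa>_def split: if_splits)
    qed
    ultimately show ?thesis
      using W by blast
  qed
  then have "openin ?\<beta> = arbitrary union_of (\<lambda>B. B \<in> {W. openin ?\<beta> W \<and> closedin ?\<beta> W})"
    unfolding openin_topology_base_unique by simp
  then show ?thesis
    unfolding strongly_zero_dimensional_def
    by (intro conjI X exI[of _ "{W. openin ?\<beta> W \<and> closedin ?\<beta> W}"]) auto
qed

section \<open>One-point extensions\<close>

lemma closed_hereditary_subset:
  fixes R :: "'a topology \<Rightarrow> bool"
  assumes inf: "infinite (UNIV :: 'a set)"
    and R: "topological_property R" "clopen_hereditary R" "inverse_invariant_perfect R"
    and X: "Hausdorff_space X" "R (subtopology X C)" "closedin X D" "D \<subseteq> C"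
  shows "R (subtopology X D)"
proof -
  have "closedin (subtopology X C) D"
    using X closedin_subset_topspace by blast
  then have "R (subtopology (subtopology X C) D)"
    using closed_hereditary[OF inf R] X Hausdorff_space_subtopology by blast
  then show ?thesis
    using X(4) by (simp add: subtopology_subtopology inf.absorb2)
qed

lemma embedding_map_subtopology_homeomorphic:
  assumes "embedding_map X Y e" "A \<subseteq> topspace X"
  shows "subtopology X A homeomorphic_space subtopology Y (e ` A)"
proof -
  have "homeomorphic_map X (subtopology Y (e ` topspace X)) e"
    using assms(1) by (simp add: embedding_map_def)
  moreover have "e ` (topspace X \<inter> A) = topspace (subtopology Y (e ` topspace X)) \<inter> e ` A"
    unfolding homeomorphic_imp_surjective_map[OF calculation, symmetric] using assms(2) by blast
  ultimately have "homeomorphic_map (subtopology X A)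
      (subtopology (subtopology Y (e ` topspace X)) (e ` A)) e"
    by (rule homeomorphic_map_subtopologies)
  moreover have "e ` topspace X \<inter> e ` A = e ` A"
    using assms(2) by blast
  ultimately have "homeomorphic_map (subtopology X A) (subtopology Y (e ` A)) e"
    by (simp only: subtopology_subtopology)
  then show ?thesis
    by (rule homeomorphic_map_imp_homeomorphic_space)
qed

text \<open>Separate \<open>e x\<close> from \<open>p\<close> by disjoint open sets \<open>G\<close>
  and \<open>H\<close>. The complement of \<open>H\<close> is closed in \<open>Y\<close>, hence has
  \<open>R\<close>; as it misses \<open>p\<close>, it is a copy of a closed subset of
  \<open>X\<close>, and this subset contains the closure of the preimage of
  \<open>G\<close>.\<close>

lemma locally_property_of_one_point_extension:
  fixes X Y :: "'a topology"
  assumes inf: "infinite (UNIV :: 'a set)"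
    and R: "topological_property R" "clopen_hereditary R" "inverse_invariant_perfect R"
    and X: "Hausdorff_space X" and Y: "Hausdorff_space Y" "R Y" and ext: "one_point_extension X Y"
  shows "locally_property R X"
  unfolding locally_property_def
proof
  fix x assume x: "x \<in> topspace X"
  obtain e p where e: "embedding_map X Y e" and p: "topspace Y - e ` topspace X = {p}"
    using ext unfolding one_point_extension_def by blast
  have ce: "continuous_map X Y e"
    using homeomorphic_imp_continuous_map[OF e[unfolded embedding_map_def]]
    by (simp add: continuous_map_in_subtopology)
  then have "e x \<in> topspace Y" "p \<in> topspace Y" "e x \<noteq> p"
    using x p by (auto dest: continuous_map_image_subset_topspace)
  then obtain G H where GH: "openin Y G" "openin Y H" "e x \<in> G" "p \<in> H" "disjnt G H"
    using Y(1) unfolding Hausdorff_space_def by blast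
  let ?U = "{x \<in> topspace X. e x \<in> G}" and ?D = "{x \<in> topspace X. e x \<in> topspace Y - H}"
  have D: "closedin X ?D"
    using closedin_continuous_map_preimage[OF ce] GH(2) by blast
  have "?U \<subseteq> ?D"
    using GH openin_subset by (fastforce simp: disjnt_iff)
  then have sub: "X closure_of ?U \<subseteq> ?D"
    using D by (rule closure_of_minimal)
  have RD: "R (subtopology X ?D)"
  proof -
    have "topspace Y \<subseteq> insert p (e ` topspace X)"
      using p by blast
    then have "e ` ?D = topspace Y - H"
      using GH(4) by auto
    moreover have "subtopology X ?D homeomorphic_space subtopology Y (e ` ?D)"
      by (rule embedding_map_subtopology_homeomorphic[OF e]) blast
    ultimately have "subtopology Y (topspace Y - H) homeomorphic_space subtopology X ?D"
      using homeomorphic_space_sym by metis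
    moreover have "R (subtopology Y (topspace Y - H))"
      using closed_hereditary[OF inf R Y] GH(2) by blast
    ultimately show ?thesis
      using topological_propertyD[OF R(1)] by blast
  qed
  have "R (subtopology X (X closure_of ?U))"
    by (rule closed_hereditary_subset[OF inf R X RD closedin_closure_of sub])
  moreover have "openin X ?U"
    using openin_continuous_map_preimage[OF ce GH(1)] .
  ultimately show "\<exists>U. openin X U \<and> x \<in> U \<and> R (subtopology X (X closure_of U))"
    using x GH(3) by blast
qed

text \<open>Depending on the value at \<open>p\<close>, either the low level set or the high one
  stays away from \<open>p\<close>. A clopen set of \<open>X\<close> around that level set remains
  clopen in \<open>Y\<close>; in the second case its complement is the separating set.\<close>

lemma one_point_extension_clopen_separation:
  fixes X Y :: "'a topology"
  assumes ext: "one_point_extension X Y" and Y: "Hausdorff_space Y" and X: "clopen_separation X"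
  shows "clopen_separation Y"
  unfolding clopen_separation_def
proof (intro allI impI)
  fix g :: "'a \<Rightarrow> real" assume g: "continuous_map Y euclideanreal g"
  obtain e p where e: "embedding_map X Y e" and p: "topspace Y - e ` topspace X = {p}"
    using ext unfolding one_point_extension_def by blast
  have topY: "topspace Y \<subseteq> insert p (e ` topspace X)"
    using p by blast
  have hom: "homeomorphic_map X (subtopology Y (e ` topspace X)) e"
    using e by (simp add: embedding_map_def)
  have ce: "continuous_map X Y e"
    using homeomorphic_imp_continuous_map[OF hom] by (simp add: continuous_map_in_subtopology)
  have ineX: "e x \<in> topspace Y" if "x \<in> topspace X" for x
    using ce that by (auto dest: continuous_map_image_subset_topspace)
  have inj: "inj_on e (topspace X)"
    using hom homeomorphic_imp_injective_map by blast
  have "closedin Y {p}"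
    using Y p closedin_Hausdorff_singleton by fastforce
  moreover have "topspace Y - {p} = e ` topspace X"
    using p ineX by blast
  ultimately have "openin Y (e ` topspace X)"
    by (metis closedin_def)
  then have op: "openin Y (e ` U)" if "openin X U" for U
    using homeomorphic_imp_open_map[OF hom] that unfolding open_map_def
    by (meson openin_trans_full)
  have cg: "continuous_map X euclideanreal (g \<circ> e)"
    using continuous_map_compose[OF ce g] .
  \<comment> \<open>The set \<open>W\<close> witnesses that \<open>e\<close>
    U\<open>stays away from\<close>p\<open>: the complement of\<close>e \<open>U\<close> is the
    union of \<open>W\<close> and the open image of \<open>topspace X - U\<close>.\<close>
  have clopen: "openin Y (e ` U) \<and> closedin Y (e ` U)"
    if U: "openin X U" "closedin X U" and W: "openin Y W" "p \<in> W" "W \<inter> e ` U = {}" for U W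
  proof -
    have sub: "U \<subseteq> topspace X" "W \<subseteq> topspace Y"
      using U(1) W(1) by (simp_all add: openin_subset)
    have "topspace Y - e ` U = e ` (topspace X - U) \<union> W"
    proof
      show "topspace Y - e ` U \<subseteq> e ` (topspace X - U) \<union> W"
        using topY W(2) by auto
      show "e ` (topspace X - U) \<union> W \<subseteq> topspace Y - e ` U"
        using inj sub W ineX by (auto dest: inj_onD)
    qed
    moreover have "openin Y (e ` (topspace X - U) \<union> W)"
      using op U(2) W(1) by (blast intro: openin_Un)
    ultimately show ?thesis
      using op[OF U(1)] openin_subset[OF op[OF U(1)]] by (simp add: closedin_def)
  qed
  have py: "p \<in> topspace Y"
    using p by blast
  show "\<exists>U. openin Y U \<and> closedin Y U \<and> {y \<in> topspace Y. g y \<le> 0} \<subseteq> U \<and> (\<forall>y\<in>U. g y < 1)"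
  proof (cases "g p > 1/2")
    case True
    obtain U where U: "openin X U" "closedin X U"
      "\<And>x. x \<in> topspace X \<Longrightarrow> (g \<circ> e) x \<le> 0 \<Longrightarrow> x \<in> U" "\<And>x. x \<in> U \<Longrightarrow> (g \<circ> e) x < 1/2"
      using clopen_separationE[OF X cg, of 0 "1/2"] by auto
    have "openin Y (e ` U) \<and> closedin Y (e ` U)"
    proof (rule clopen[OF U(1,2)])
      show "openin Y {y \<in> topspace Y. 1/2 < g y}"
        using openin_real_preimage_less[OF g] by blast
      show "{y \<in> topspace Y. 1/2 < g y} \<inter> e ` U = {}"
        using U(4) by force
    qed (use True py in auto)
    moreover have "{y \<in> topspace Y. g y \<le> 0} \<subseteq> e ` U"
    proof clarify
      fix y assume y: "y \<in> topspace Y" "g y \<le> 0"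
      then have "y \<noteq> p"
        using True by auto
      then obtain x where "x \<in> topspace X" "y = e x"
        using topY y(1) by blast
      then show "y \<in> e ` U"
        using U(3)[of x] y by simp
    qed
    moreover have "\<forall>y\<in>e ` U. g y < 1"
      using U(4) by fastforce
    ultimately show ?thesis by blast
  next
    case False
    have "continuous_map X euclideanreal (\<lambda>x. - (g \<circ> e) x)"
      using cg by (rule continuous_map_minus)
    \<comment> \<open>Negation turns the high level set into a low one: \<open>U\<close> contains
      the points with value at least 1 and has only values above \<open>3/4\<close>. Since the value
      at \<open>p\<close> is at most \<open>1/2\<close>, the set where \<open>g < 3/4\<close> is a
      neighbourhood of \<open>p\<close> missing the image of \<open>U\<close>.\<close>
    then obtain U where U: "openin X U" "closedin X U"
      "\<And>x. x \<in> topspace X \<Longrightarrow> - (g \<circ> e) x \<le> -1 \<Longrightarrow> x \<in> U" "\<And>x. x \<in> U \<Longrightarrow> - (g \<circ> e) x < -(3/4)"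
      using clopen_separationE[OF X, of "\<lambda>x. - (g \<circ> e) x" "-1" "-(3/4)"] by auto
    have "openin Y (e ` U) \<and> closedin Y (e ` U)"
    proof (rule clopen[OF U(1,2)])
      show "openin Y {y \<in> topspace Y. g y < 3/4}"
        using openin_real_preimage_less[OF g] by blast
      show "{y \<in> topspace Y. g y < 3/4} \<inter> e ` U = {}"
        using U(4) by force
    qed (use False py in auto)
    then have "openin Y (topspace Y - e ` U)" "closedin Y (topspace Y - e ` U)"
      by (simp_all add: openin_diff closedin_diff)
    moreover have "{y \<in> topspace Y. g y \<le> 0} \<subseteq> topspace Y - e ` U"
      using U(4) by force
    moreover have "\<forall>y\<in>topspace Y - e ` U. g y < 1"
    proof (rule ccontr)
      assume "\<not> ?thesis"
      then obtain y where y: "y \<in> topspace Y" "y \<notin> e ` U" "1 \<le> g y"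
        by force
      then have "y \<noteq> p"
        using False by auto
      then obtain x where "x \<in> topspace X" "y = e x"
        using topY y(1) by blast
      then show False
        using U(3)[of x] y by simp
    qed
    ultimately show ?thesis by blast
  qed
qed

section \<open>Construction of the extension\<close>

text \<open>With compactness as \<open>R\<close> this is \<open>C_0(X)\<close>, the continuous
  functions vanishing at infinity.\<close>

definition vanishing_functions :: "('a topology \<Rightarrow> bool) \<Rightarrow> 'a topology \<Rightarrow> ('a \<Rightarrow> real) set" where
  "vanishing_functions R X = {f. continuous_map X euclideanreal f \<and>
     (\<forall>\<epsilon>>0. R (subtopology X {x \<in> topspace X. \<epsilon> \<le> \<bar>f x\<bar>}))}"

lemma closedin_abs_ge:
  fixes f :: "'a \<Rightarrow> real"
  assumes "continuous_map X euclideanreal f"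
  shows "closedin X {x \<in> topspace X. c \<le> \<bar>f x\<bar>}"
  using closedin_real_preimage_le(2)[OF continuous_map_real_abs[OF assms]] .

text \<open>Shrink \<open>U\<close> by an open \<open>V\<close> whose closure has \<open>R\<close>
  and apply complete regularity to \<open>U \<inter> V\<close>. The sets where
  \<open>\<bar>f\<bar> \<ge> \<epsilon>\<close> are then closed subsets of the closure of
  \<open>V\<close>.\<close>

lemma vanishing_functions_separate:
  fixes X :: "'a topology"
  assumes inf: "infinite (UNIV :: 'a set)"
    and R: "topological_property R" "clopen_hereditary R" "inverse_invariant_perfect R"
    and X: "Tychonoff_space X" and loc: "locally_property R X" and U: "openin X U" "x \<in> U"
  obtains f where "f \<in> vanishing_functions R X" "f x = 1" "\<And>y. y \<in> topspace X - U \<Longrightarrow> f y = 0"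
proof -
  have "x \<in> topspace X"
    using U openin_subset by blast
  then obtain V where V: "openin X V" "x \<in> V" "R (subtopology X (X closure_of V))"
    using loc unfolding locally_property_def by blast
  have "completely_regular_space X"
    using X by (simp add: Tychonoff_space_def)
  moreover have "openin X (U \<inter> V)" "x \<in> U \<inter> V"
    using U V by auto
  ultimately obtain f where f: "continuous_map X euclideanreal f" "f x = 1"
    "f ` (topspace X - U \<inter> V) \<subseteq> {0}"
    using completely_regular_space_gen_alt'[of "1::real" 0 X] by (metis zero_neq_one)
  have "R (subtopology X {y \<in> topspace X. \<epsilon> \<le> \<bar>f y\<bar>})" if "\<epsilon> > 0" for \<epsilon>
  proof -
    have "y \<in> V" if "y \<in> topspace X" "\<epsilon> \<le> \<bar>f y\<bar>" for y
    proof (rule ccontr)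
      assume "y \<notin> V"
      then have "f y = 0"
        using f(3) that(1) by auto
      then show False
        using that(2) \<open>\<epsilon> > 0\<close> by simp
    qed
    then have "{y \<in> topspace X. \<epsilon> \<le> \<bar>f y\<bar>} \<subseteq> X closure_of V"
      using closure_of_subset[OF openin_subset[OF V(1)]] by blast
    then show ?thesis
      using closed_hereditary_subset[OF inf R _ V(3) closedin_abs_ge[OF f(1)]] X
      by (simp add: Tychonoff_space_def)
  qed
  then show thesis
    using that f by (auto simp: vanishing_functions_def)
qed

text \<open>The last conclusion is the input for condition (W). It also yields density: an open
  \<open>B\<close> around \<open>p\<close> missing the image of \<open>X\<close> would give
  \<open>R X\<close>.\<close>

lemma one_point_extension_exists:
  fixes X :: "'a topology"
  assumes R: "compactness_like R" and X: "Tychonoff_space X" "\<not> R X" and loc: "locally_property R X"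
  obtains Y :: "'a topology" and e p where "embedding_map X Y e" "Tychonoff_space Y"
    "Y closure_of (e ` topspace X) = topspace Y" "topspace Y - e ` topspace X = {p}"
    "\<And>B. openin Y B \<Longrightarrow> p \<in> B \<Longrightarrow> R (subtopology X {x \<in> topspace X. e x \<notin> B})"
proof -
  have HX: "Hausdorff_space X"
    using X by (simp add: Tychonoff_space_def)
  have R': "topological_property R" "clopen_hereditary R" "inverse_invariant_perfect R"
    using R by (auto simp: compactness_like_def perfect_property_def)
  have "infinite (topspace X)"
    by (rule compactness_like_imp_infinite[OF R HX X(2)])
  then have inf: "infinite (UNIV :: 'a set)"
    by (rule infinite_super[OF subset_UNIV])
  define F where "F = vanishing_functions R X"
  have FC: "continuous_map X euclideanreal f" if "f \<in> F" for f
    using that by (simp add: F_def vanishing_functions_def)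
  have sepX: "\<exists>f\<in>F. f x = 1 \<and> (\<forall>y\<in>topspace X - U. f y = 0)"
    if "openin X U" "x \<in> U" for U x
    using vanishing_functions_separate[OF inf R' X(1) loc that] unfolding F_def by metis
  \<comment> \<open>An infinite set is in bijection with itself minus a point. Moving
    \<open>X\<close> along \<open>e\<close> frees the point \<open>p\<close>, even if the carrier of
    \<open>X\<close> is the whole type.\<close>
  obtain p e where e: "bij_betw e (topspace X) (topspace X - {p})"
    using infinite_imp_bij_betw[OF \<open>infinite (topspace X)\<close>] by blast
  have inj: "inj_on e (topspace X)" and pe: "p \<notin> e ` topspace X"
    using e by (auto simp: bij_betw_def)
  \<comment> \<open>The tuple of values at \<open>y\<close> of all extended functions:
    \<open>inv_into\<close> recovers the point of \<open>X\<close>, and \<open>p\<close> gets 0 in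
    every coordinate.\<close>
  define \<phi> where "\<phi> y = (\<lambda>f\<in>F. if y = p then 0 else f (inv_into (topspace X) e y))" for y
  have \<phi>e: "\<phi> (e x) f = f x" if "x \<in> topspace X" "f \<in> F" for x f
    using that pe inj by (auto simp: \<phi>_def)
  have \<phi>p: "\<phi> p f = 0" if "f \<in> F" for f
    using that by (simp add: \<phi>_def)
  let ?S = "insert p (e ` topspace X)"
  define T :: "(('a \<Rightarrow> real) \<Rightarrow> real) topology" where "T = product_topology (\<lambda>_. euclideanreal) F"
  \<comment> \<open>This is the weak topology of the extended functions. Once \<open>\<phi>\<close>
    is known to be injective, \<open>Y\<close> is a subspace of a product of real lines, hence
    Tychonoff.\<close>
  define Y where "Y = pullback_topology ?S \<phi> T"
  have \<phi>T: "\<phi> y \<in> topspace T" for y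
    by (simp add: T_def \<phi>_def)
  have topY: "topspace Y = ?S"
    using \<phi>T by (auto simp: Y_def topspace_pullback_topology)
  have sep: "\<exists>f\<in>F. \<phi> (e x) f = 1 \<and> \<phi> y f = 0" if x: "x \<in> topspace X" and y: "y \<in> ?S" "y \<noteq> e x" for x y
  proof (cases "y = p")
    case True
    obtain f where "f \<in> F" "f x = 1"
      using sepX[OF openin_topspace x] by blast
    then show ?thesis
      using \<phi>e \<phi>p x True by metis
  next
    case False
    then obtain z where z: "z \<in> topspace X" "y = e z"
      using y by blast
    have "openin X (topspace X - {z})" "x \<in> topspace X - {z}"
      using HX z y x by (auto simp: closedin_Hausdorff_singleton openin_diff)
    then obtain f where "f \<in> F" "f x = 1" "f z = 0"
      using sepX[of "topspace X - {z}" x] z by blast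
    then show ?thesis
      using \<phi>e x z by metis
  qed
  have inj\<phi>: "inj_on \<phi> ?S"
  proof (rule inj_onI, rule ccontr)
    fix y z assume yz: "y \<in> ?S" "z \<in> ?S" "\<phi> y = \<phi> z" "y \<noteq> z"
    then consider x where "x \<in> topspace X" "y = e x" | x where "x \<in> topspace X" "z = e x"
      by blast
    then show False
    proof cases
      case 1
      then show False
        using sep[of x z] yz by force
    next
      case 2
      then show False
        using sep[of x y] yz by force
    qed
  qed
  have "homeomorphic_map Y (subtopology T (\<phi> ` ?S)) \<phi>"
    unfolding Y_def using \<phi>T by (intro homeomorphic_map_pullback_topology inj\<phi>) auto
  moreover have "Tychonoff_space T"
    unfolding T_def by (intro Tychonoff_space_product_topology Tychonoff_space_euclidean)
  ultimately have TY: "Tychonoff_space Y"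
    using Tychonoff_space_homeomorphic Tychonoff_space_subtopology
      homeomorphic_map_imp_homeomorphic_space by blast
  have ce: "continuous_map X Y e"
    unfolding Y_def
  proof (rule continuous_map_pullback')
    show "continuous_map X T (\<phi> \<circ> e)"
      unfolding T_def continuous_map_componentwise
    proof (intro conjI ballI)
      show "(\<phi> \<circ> e) ` topspace X \<subseteq> extensional F"
        by (auto simp: \<phi>_def)
      show "continuous_map X euclideanreal (\<lambda>x. (\<phi> \<circ> e) x f)" if "f \<in> F" for f
        using FC[OF that] by (rule continuous_map_eq) (simp add: \<phi>e that)
    qed
  qed auto
  have cproj: "continuous_map Y euclideanreal (\<lambda>y. \<phi> y f)" if "f \<in> F" for f
  proof -
    have "continuous_map T euclideanreal (\<lambda>z. z f)"
      unfolding T_def using continuous_map_product_projection[OF that, of "\<lambda>_. euclideanreal"] .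
    then have "continuous_map Y euclideanreal ((\<lambda>z. z f) \<circ> \<phi>)"
      unfolding Y_def by (rule continuous_map_pullback)
    then show ?thesis
      by (simp add: o_def)
  qed
  have "open_map X Y e"
    unfolding open_map_def
  proof (intro allI impI)
    fix U assume U: "openin X U"
    show "openin Y (e ` U)"
    proof (subst openin_subopen, clarify)
      fix x assume x: "x \<in> U"
      then have xX: "x \<in> topspace X"
        using U openin_subset by blast
      obtain f where f: "f \<in> F" "f x = 1" "\<And>y. y \<in> topspace X - U \<Longrightarrow> f y = 0"
        using sepX[OF U x] by blast
      let ?W = "{y \<in> topspace Y. 0 < \<phi> y f}"
      have "openin Y ?W"
        using openin_real_preimage_less(2)[OF cproj[OF f(1)]] .
      moreover have "e x \<in> ?W"
        using xX f topY \<phi>e by simp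
      moreover have "?W \<subseteq> e ` U"
      proof clarify
        fix y assume y: "y \<in> topspace Y" "0 < \<phi> y f"
        then obtain z where z: "z \<in> topspace X" "y = e z"
          using topY \<phi>p[OF f(1)] by force
        then have "0 < f z"
          using y \<phi>e[OF z(1) f(1)] by simp
        then show "y \<in> e ` U"
          using f(3) z by force
      qed
      ultimately show "\<exists>W. openin Y W \<and> e x \<in> W \<and> W \<subseteq> e ` U"
        by blast
    qed
  qed
  then have emb: "embedding_map X Y e"
    using ce inj injective_open_imp_embedding_map by blast
  \<comment> \<open>A basic product neighbourhood of \<open>\<phi> p\<close> restricts only the
    finitely many coordinates in \<open>?J\<close>. A point \<open>x\<close> with \<open>e x\<close>
    outside \<open>B\<close> violates one of these restrictions, so some \<open>f\<close> in
    \<open>?J\<close> has \<open>\<bar>f x\<bar> \<ge> \<epsilon> f\<close>.\<close>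
  have nbhd: "R (subtopology X {x \<in> topspace X. e x \<notin> B})" if B: "openin Y B" "p \<in> B" for B
  proof -
    obtain V where V: "openin T V" "B = \<phi> -` V \<inter> ?S"
      using B(1) by (auto simp: Y_def openin_pullback_topology)
    then have "\<phi> p \<in> V"
      using B(2) by blast
    then obtain U where U: "finite {f \<in> F. U f \<noteq> UNIV}" "\<And>f. f \<in> F \<Longrightarrow> open (U f)"
      "\<phi> p \<in> Pi\<^sub>E F U" "Pi\<^sub>E F U \<subseteq> V"
      using V(1) by (fastforce simp: T_def openin_product_topology_alt)
    let ?J = "{f \<in> F. U f \<noteq> UNIV}"
    have "\<exists>\<epsilon>>0. \<forall>t. \<bar>t\<bar> < \<epsilon> \<longrightarrow> t \<in> U f" if f: "f \<in> F" for f
    proof -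
      have "0 \<in> U f"
        using U(3) f \<phi>p[OF f] by (metis PiE_mem)
      then obtain \<epsilon> where "\<epsilon> > 0" "ball 0 \<epsilon> \<subseteq> U f"
        using U(2)[OF f] openE by blast
      then show ?thesis
        by (intro exI[of _ \<epsilon>]) (auto simp: subset_iff)
    qed
    then obtain \<epsilon> where \<epsilon>: "\<And>f. f \<in> F \<Longrightarrow> \<epsilon> f > 0" "\<And>f t. f \<in> F \<Longrightarrow> \<bar>t\<bar> < \<epsilon> f \<Longrightarrow> t \<in> U f"
      by metis
    let ?C = "\<lambda>f. {x \<in> topspace X. \<epsilon> f \<le> \<bar>f x\<bar>}"
    have 1: "R (subtopology X (\<Union>f\<in>?J. ?C f))"
    proof (rule compactness_like_UN[OF inf R HX U(1)])
      show "closedin X (?C f)" if "f \<in> ?J" for f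
        using closedin_abs_ge[OF FC] that by blast
      show "R (subtopology X (?C f))" if "f \<in> ?J" for f
        using that \<epsilon>(1) by (auto simp: F_def vanishing_functions_def)
    qed
    have 2: "{x \<in> topspace X. e x \<notin> B} \<subseteq> (\<Union>f\<in>?J. ?C f)"
    proof (rule subsetI, rule ccontr)
      fix x assume x: "x \<in> {x \<in> topspace X. e x \<notin> B}" "x \<notin> (\<Union>f\<in>?J. ?C f)"
      have "\<phi> (e x) f \<in> U f" if "f \<in> F" for f
      proof (cases "U f = UNIV")
        case False
        then have "\<bar>f x\<bar> < \<epsilon> f"
          using x that by auto
        then show ?thesis
          using \<epsilon>(2) that x \<phi>e by simp
      qed simp
      moreover have "\<phi> (e x) \<in> extensional F"
        by (simp add: \<phi>_def)
      ultimately have "\<phi> (e x) \<in> Pi\<^sub>E F U"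
        by (simp add: PiE_iff)
      then show False
        using U(4) V(2) x by blast
    qed
    have 3: "closedin X {x \<in> topspace X. e x \<notin> B}"
    proof -
      have "{x \<in> topspace X. e x \<notin> B} = topspace X - {x \<in> topspace X. e x \<in> B}"
        by blast
      then show ?thesis
        using openin_continuous_map_preimage[OF ce B(1)] by (metis closedin_diff closedin_topspace)
    qed
    show ?thesis
      by (rule closed_hereditary_subset[OF inf R' HX 1 3 2])
  qed
  have "Y closure_of (e ` topspace X) = topspace Y"
  proof
    have "p \<in> Y closure_of (e ` topspace X)"
    proof (rule ccontr)
      assume "\<not> ?thesis"
      then obtain B where B: "openin Y B" "p \<in> B" "\<And>x. x \<in> topspace X \<Longrightarrow> e x \<notin> B"
        using topY by (auto simp: in_closure_of)
      then have "{x \<in> topspace X. e x \<notin> B} = topspace X"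
        by blast
      then show False
        using nbhd[OF B(1,2)] X(2) by simp
    qed
    moreover have "e ` topspace X \<subseteq> Y closure_of (e ` topspace X)"
      by (rule closure_of_subset) (auto simp: topY)
    ultimately show "topspace Y \<subseteq> Y closure_of (e ` topspace X)"
      using topY by simp
  qed (rule closure_of_subset_topspace)
  moreover have "topspace Y - e ` topspace X = {p}"
    using topY pe by blast
  ultimately show thesis
    using that emb TY nbhd by blast
qed

text \<open>Condition (W) is applied at \<open>p\<close> with all its open neighbourhoods as base;
  their complements in \<open>Y\<close> miss \<open>p\<close> and so are copies of closed subsets of
  \<open>X\<close>. Serves for \<open>P\<close> and \<open>Q\<close> alike.\<close>

lemma Mrowka_W_one_point:
  assumes R: "topological_property R" "Mrowka_W R" and Y: "Tychonoff_space Y"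
    and e: "embedding_map X Y e" and p: "topspace Y - e ` topspace X = {p}"
    and nbhd: "\<And>B. openin Y B \<Longrightarrow> p \<in> B \<Longrightarrow> R (subtopology X {x \<in> topspace X. e x \<notin> B})"
  shows "R Y"
proof -
  let ?B = "{B. openin Y B \<and> p \<in> B}"
  have "e ` topspace X \<subseteq> topspace Y"
    using homeomorphic_imp_surjective_map[OF e[unfolded embedding_map_def]]
    by (metis inf_le1 topspace_subtopology)
  have "R (subtopology Y (topspace Y - B))" if "B \<in> ?B" for B
  proof -
    have "topspace Y \<subseteq> insert p (e ` topspace X)"
      using p by blast
    then have "e ` {x \<in> topspace X. e x \<notin> B} = topspace Y - B"
      using that \<open>e ` topspace X \<subseteq> topspace Y\<close> by auto
    moreover have "subtopology X {x \<in> topspace X. e x \<notin> B} homeomorphic_space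
        subtopology Y (e ` {x \<in> topspace X. e x \<notin> B})"
      by (rule embedding_map_subtopology_homeomorphic[OF e]) blast
    moreover have "R (subtopology X {x \<in> topspace X. e x \<notin> B})"
      using nbhd that by blast
    ultimately show ?thesis
      using topological_propertyD[OF R(1)] by metis
  qed
  moreover have "open_base_at Y p ?B"
    by (auto simp: open_base_at_def)
  moreover have "p \<in> topspace Y"
    using p by blast
  ultimately show ?thesis
    using R(2) Y unfolding Mrowka_W_def by blast
qed

theorem theorem5p9:
  fixes P Q :: "'a topology \<Rightarrow> bool" and X :: "'a topology"
  assumes P: "compactness_like P"
    and Q: "(topological_property Q \<and> clopen_hereditary Q \<and> inverse_invariant_perfect Q \<and> Mrowka_W Q)
            \<or> Q = strongly_zero_dimensional"
    and X: "Tychonoff_space X" "\<not> P X" "Q X"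
  shows "locally_property P X \<longleftrightarrow>
         (\<exists>Y :: 'a topology. one_point_extension X Y \<and> Tychonoff_space Y \<and> P Y \<and> Q Y)"
proof
  have HX: "Hausdorff_space X"
    using X by (simp add: Tychonoff_space_def)
  have P': "topological_property P" "clopen_hereditary P" "inverse_invariant_perfect P" "Mrowka_W P"
    using P by (auto simp: compactness_like_def perfect_property_def)
  \<comment> \<open>Infinitude comes from the failure of \<open>P\<close>, and it also provides the
    sums needed when closed subsets inherit \<open>Q\<close>.\<close>
  have "infinite (topspace X)"
    by (rule compactness_like_imp_infinite[OF P HX X(2)])
  then have inf: "infinite (UNIV :: 'a set)"
    by (rule infinite_super[OF subset_UNIV])
  show "locally_property P X"
    if "\<exists>Y :: 'a topology. one_point_extension X Y \<and> Tychonoff_space Y \<and> P Y \<and> Q Y"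
    using that locally_property_of_one_point_extension[OF inf P'(1-3) HX]
    unfolding Tychonoff_space_def by metis
  assume loc: "locally_property P X"
  obtain Y :: "'a topology" and e p where e: "embedding_map X Y e" and Y: "Tychonoff_space Y"
    and ext: "Y closure_of (e ` topspace X) = topspace Y" "topspace Y - e ` topspace X = {p}"
    and nbhd: "\<And>B. openin Y B \<Longrightarrow> p \<in> B \<Longrightarrow> P (subtopology X {x \<in> topspace X. e x \<notin> B})"
    by (rule one_point_extension_exists[OF P X(1,2) loc]) blast
  have one: "one_point_extension X Y"
    unfolding one_point_extension_def using e ext by blast
  have "P Y"
    using Mrowka_W_one_point[OF P'(1,4) Y e ext(2) nbhd] .
  moreover have "Q Y"
    using Q
  proof
    assume "topological_property Q \<and> clopen_hereditary Q \<and> inverse_invariant_perfect Q \<and> Mrowka_W Q"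
    then have Q': "topological_property Q" "clopen_hereditary Q" "inverse_invariant_perfect Q" "Mrowka_W Q"
      by simp_all
    have ce: "continuous_map X Y e"
      using homeomorphic_imp_continuous_map[OF e[unfolded embedding_map_def]]
      by (simp add: continuous_map_in_subtopology)
    have "Q (subtopology X {x \<in> topspace X. e x \<notin> B})" if "openin Y B" for B
    proof -
      have "{x \<in> topspace X. e x \<notin> B} = topspace X - {x \<in> topspace X. e x \<in> B}"
        by blast
      then have "closedin X {x \<in> topspace X. e x \<notin> B}"
        using openin_continuous_map_preimage[OF ce that] by (metis closedin_diff closedin_topspace)
      then show ?thesis
        by (rule closed_hereditary[OF inf Q'(1-3) HX X(3)])
    qed
    then show "Q Y"
      using Mrowka_W_one_point[OF Q'(1,4) Y e ext(2)] by simp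
  next
    assume Q: "Q = strongly_zero_dimensional"
    then have "clopen_separation Y"
      using strongly_zero_dimensional_imp_clopen_separation X(3)
        one_point_extension_clopen_separation[OF one] Y
      unfolding Tychonoff_space_def by blast
    then show "Q Y"
      using clopen_separation_imp_strongly_zero_dimensional[OF Y] Q by blast
  qed
  ultimately show "\<exists>Y :: 'a topology. one_point_extension X Y \<and> Tychonoff_space Y \<and> P Y \<and> Q Y"
    using one Y by blast
qed

end
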